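(* Let $k\ge 1$ and $n=k+1$. For every position $x$ of the game $\mathrm{NIM}(n,k)=\mathrm{NIM}(n,n-1)$ the equalities $$m(x)=\mathcal{M}(x)=\mathcal{R}(x)$$ hold.
   Context: The game $\mathrm{NIM}(n,k)$ ($0<k\le n$): a position is an $n$-tuple $x=(x_1,\dots,x_n)$ of nonnegative integers (pile sizes). By one move a player chooses $k$ piles, all of them nonempty, and removes exactly one stone from each of them. Two players alternate turns; a player who has to move but cannot loses. A position is terminal if no move is possible from it. Here $n=k+1$, so a move keeps exactly one pile and reduces all the others by $1$. M-rule (for $n=k+1$): from a nonterminal position, if all piles are odd, keep a largest pile and reduce all others by one; if there are even piles, keep a smallest even pile and reduce all others by one (0 counts as even). This defines a unique move up to renumbering of the piles. $\mathcal{M}(x)$ denotes the number of moves made from $x$ until a terminal position is reached when both players always follow the M-rule. For $n$-vectors $x,y$, let $x^*,y^*$ be obtained by sorting the coordinates in nondecreasing order. Write $x\succeq y$ if $x^*_i\ge y^*_i$ for all $i\in\{1,\dots,n\}$, and $x\succ y$ if in addition $x^*\ne y^*$. For a nonnegative integer $m$, a position $x$ is called $m$-critical if $\mathcal{M}(x)=m$ and there is no position $y$ with $\mathcal{M}(y)=m$ and $x\succ y$. For a position $y$, $m(y)$ denotes the unique nonnegative integer $m$ such that $y\succeq x$ holds for some $m$-critical position $x$ and $y\succeq x$ fails for every $(m+1)$-critical position $x$. Smith's remoteness function $\mathcal{R}$ is defined by the following labeling of the positions of the game: set $\mathcal{R}=0$ for all terminal positions and $\mathcal{R}(x)=1$ if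 and only if there is a move from $x$ to a terminal position; delete all labeled positions and repeat the procedure on the remaining digraph with labels increased by $2$ (that is, assign $2$ and $3$ instead of $0$ and $1$), and so on. Equivalently, with $N^+(x)$ the set of positions reachable from $x$ by one move: $\mathcal{R}(x)=0$ if $N^+(x)=\emptyset$; $\mathcal{R}(x)=1+\min\{\mathcal{R}(y): y\in N^+(x),\ \mathcal{R}(y)\text{ even}\}$ if some $y\in N^+(x)$ has even $\mathcal{R}(y)$; and $\mathcal{R}(x)=1+\max\{\mathcal{R}(y): y\in N^+(x)\}$ if $N^+(x)\ne\emptyset$ and all $y\in N^+(x)$ have odd $\mathcal{R}(y)$. *)

theory Defs
  imports "HOL-Library.Multiset"
begin

text \<open>
  A position of NIM(n,k) is a list of \<open>n\<close> natural numbers.  The number of piles is the length of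
  the list, so only \<open>k\<close> is a parameter of the move relation.
\<close>

definition nim_move :: "nat \<Rightarrow> nat list \<Rightarrow> nat list \<Rightarrow> bool" where
  "nim_move k x y \<longleftrightarrow> (\<exists>S. S \<subseteq> {..<length x} \<and> card S = k \<and> (\<forall>i\<in>S. 0 < x ! i) \<and>
     y = map (\<lambda>i. if i \<in> S then x ! i - 1 else x ! i) [0..<length x])"

definition terminal :: "nat \<Rightarrow> nat list \<Rightarrow> bool" where
  "terminal k x \<longleftrightarrow> \<not> (\<exists>y. nim_move k x y)"

definition M_keeps :: "nat list \<Rightarrow> nat \<Rightarrow> bool" where
  "M_keeps x i \<longleftrightarrow> i < length x \<and>
     (if \<forall>j<length x. odd (x ! j)
      then \<forall>j<length x. x ! j \<le> x ! i
      else even (x ! i) \<and> (\<forall>j<length x. even (x ! j) \<longrightarrow> x ! i \<le> x ! j))"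

definition reduce_others :: "nat \<Rightarrow> nat list \<Rightarrow> nat list" where
  "reduce_others i x = (map (\<lambda>v. v - 1) x)[i := x ! i]"

text \<open>
  The M-rule is a relation, because the pile to be kept need not be unique.  It is meant for
  \<open>length x = k + 1\<close>; then the truncated subtraction in \<open>reduce_others\<close> is never applied to an
  empty pile (lemma \<open>M_move_legal\<close>), and the number of moves does not depend on the choices
  (lemma \<open>ex1_M_moves\<close>).
\<close>

definition M_move :: "nat \<Rightarrow> nat list \<Rightarrow> nat list \<Rightarrow> bool" where
  "M_move k x y \<longleftrightarrow> \<not> terminal k x \<and> (\<exists>i. M_keeps x i \<and> y = reduce_others i x)"

definition M_moves :: "nat \<Rightarrow> nat list \<Rightarrow> nat \<Rightarrow> bool" where
  "M_moves k x m \<longleftrightarrow> (\<exists>y. (M_move k ^^ m) x y \<and> terminal k y)"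

definition M_num :: "nat \<Rightarrow> nat list \<Rightarrow> nat" where
  "M_num k x = (THE m. M_moves k x m)"

definition dominates :: "nat list \<Rightarrow> nat list \<Rightarrow> bool" where
  "dominates x y \<longleftrightarrow> length x = length y \<and> (\<forall>i<length x. sort x ! i \<ge> sort y ! i)"

definition strictly_dominates :: "nat list \<Rightarrow> nat list \<Rightarrow> bool" where
  "strictly_dominates x y \<longleftrightarrow> dominates x y \<and> sort x \<noteq> sort y"

definition critical :: "nat \<Rightarrow> nat \<Rightarrow> nat list \<Rightarrow> bool" where
  "critical k m x \<longleftrightarrow> length x = k + 1 \<and> M_num k x = m \<and>
     \<not> (\<exists>y. length y = k + 1 \<and> M_num k y = m \<and> strictly_dominates x y)"

definition m_num :: "nat \<Rightarrow> nat list \<Rightarrow> nat" where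
  "m_num k y = (THE m. (\<exists>x. critical k m x \<and> dominates y x) \<and>
                       (\<forall>x. critical k (m + 1) x \<longrightarrow> \<not> dominates y x))"

text \<open>
  The labeling procedure on a digraph with edge relation \<open>E\<close>.  In round \<open>j\<close> the vertices in
  \<open>labeled E j\<close> have been deleted; the vertices that are terminal in the remaining digraph receive
  the label \<open>2 * j\<close>, those with an edge to such a vertex receive the label \<open>2 * j + 1\<close>.
\<close>

definition remaining_terminal :: "('a \<Rightarrow> 'a \<Rightarrow> bool) \<Rightarrow> 'a set \<Rightarrow> 'a set" where
  "remaining_terminal E D = {x. x \<notin> D \<and> \<not> (\<exists>y. y \<notin> D \<and> E x y)}"

definition before_terminal :: "('a \<Rightarrow> 'a \<Rightarrow> bool) \<Rightarrow> 'a set \<Rightarrow> 'a set" where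
  "before_terminal E D = {x. x \<notin> D \<and> (\<exists>y\<in>remaining_terminal E D. E x y)}"

primrec labeled :: "('a \<Rightarrow> 'a \<Rightarrow> bool) \<Rightarrow> nat \<Rightarrow> 'a set" where
  "labeled E 0 = {}"
| "labeled E (Suc j) =
     labeled E j \<union> remaining_terminal E (labeled E j) \<union> before_terminal E (labeled E j)"

definition has_label :: "('a \<Rightarrow> 'a \<Rightarrow> bool) \<Rightarrow> 'a \<Rightarrow> nat \<Rightarrow> bool" where
  "has_label E x r \<longleftrightarrow>
     (\<exists>j. (r = 2 * j \<and> x \<in> remaining_terminal E (labeled E j)) \<or>
          (r = 2 * j + 1 \<and> x \<in> before_terminal E (labeled E j)))"

definition remoteness :: "('a \<Rightarrow> 'a \<Rightarrow> bool) \<Rightarrow> 'a \<Rightarrow> nat" where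
  "remoteness E x = (THE r. has_label E x r)"

lemma length_reduce_others [simp]: "length (reduce_others i x) = length x"
  by (simp add: reduce_others_def)

lemma mset_reduce_others:
  assumes "i < length x"
  shows "mset (reduce_others i x) =
    add_mset (x ! i) (image_mset (\<lambda>v. v - 1) (mset x) - {#x ! i - 1#})"
  using assms by (simp add: reduce_others_def mset_update)

lemma sum_list_nim_move:
  assumes "nim_move k x y" "0 < k"
  shows "length y = length x" "sum_list y < sum_list x"
proof -
  obtain S where S: "S \<subseteq> {..<length x}" "card S = k" "\<forall>i\<in>S. 0 < x ! i"
    and y: "y = map (\<lambda>i. if i \<in> S then x ! i - 1 else x ! i) [0..<length x]"
    using assms(1) unfolding nim_move_def by blast
  show len: "length y = length x" using y by simp
  obtain a where a: "a \<in> S" using S(2) assms(2) by fastforce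
  have "(\<Sum>i = 0..<length x. y ! i) < (\<Sum>i = 0..<length x. x ! i)"
  proof (rule sum_strict_mono_ex1)
    show "\<forall>i\<in>{0..<length x}. y ! i \<le> x ! i" using y by simp
    have "y ! a < x ! a" "a \<in> {0..<length x}" using y a S by auto
    then show "\<exists>i\<in>{0..<length x}. y ! i < x ! i" by blast
  qed simp
  then show "sum_list y < sum_list x" using len by (simp add: sum_list_sum_nth)
qed

lemma terminal_iff: "terminal k x \<longleftrightarrow> size (filter_mset (\<lambda>v. 0 < v) (mset x)) < k"
proof -
  let ?P = "{i. i < length x \<and> 0 < x ! i}"
  have size: "size (filter_mset (\<lambda>v. 0 < v) (mset x)) = card ?P"
    by (metis length_filter_conv_card mset_filter size_mset)
  have "(\<exists>y. nim_move k x y) \<longleftrightarrow> (\<exists>S. S \<subseteq> ?P \<and> card S = k)"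
    unfolding nim_move_def by (auto simp: subset_iff)
  also have "\<dots> \<longleftrightarrow> k \<le> card ?P"
    using obtain_subset_with_card_n[of k ?P] card_mono[of ?P]
    by (metis (no_types, lifting) finite_nat_set_iff_bounded mem_Collect_eq)
  finally show ?thesis unfolding terminal_def size by (simp add: not_le)
qed

lemma M_move_legal:
  assumes "M_move k x y" "length x = k + 1"
  shows "nim_move k x y"
proof -
  obtain i where i: "M_keeps x i" "y = reduce_others i x" and nt: "\<not> terminal k x"
    using assms(1) unfolding M_move_def by blast
  obtain S where S: "S \<subseteq> {..<length x}" "card S = k" "\<forall>j\<in>S. 0 < x ! j"
    using nt unfolding terminal_def nim_move_def by blast
  have il: "i < length x" using i(1) by (simp add: M_keeps_def)
  have pos: "0 < x ! j" if j: "j < length x" "j \<noteq> i" for j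
  proof (rule ccontr)
    assume "\<not> 0 < x ! j"
    then have z: "x ! j = 0" by simp
    then have "\<not> (\<forall>j<length x. odd (x ! j))" using j by auto
    then have "x ! i \<le> x ! j" using i(1) j(1) z unfolding M_keeps_def by (metis even_zero)
    then have "x ! i = 0" using z by simp
    then have "S \<subseteq> {..<length x} - {i, j}" using S z by auto
    then have "card S \<le> card ({..<length x} - {i, j})" by (intro card_mono) auto
    also have "\<dots> = length x - 2" using il j by (subst card_Diff_subset) auto
    finally have "k \<le> length x - 2" using S(2) by simp
    moreover have "2 \<le> length x" using il j by linarith
    ultimately show False using assms(2) by linarith
  qed
  show ?thesis unfolding nim_move_def
  proof (intro exI conjI)
    show "{..<length x} - {i} \<subseteq> {..<length x}" by auto
    show "card ({..<length x} - {i}) = k" using il assms(2) by simp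
    show "\<forall>j\<in>{..<length x} - {i}. 0 < x ! j" using pos by auto
    show "y = map (\<lambda>j. if j \<in> {..<length x} - {i} then x ! j - 1 else x ! j) [0..<length x]"
      using il by (auto simp: i(2) reduce_others_def nth_list_update intro!: nth_equalityI)
  qed
qed

lemma ex_M_keeps:
  assumes "x \<noteq> []"
  shows "\<exists>i. M_keeps x i"
proof (cases "\<forall>j<length x. odd (x ! j)")
  case True
  have "Max (set x) \<in> set x" using assms by simp
  then obtain i where "i < length x" "x ! i = Max (set x)" by (metis in_set_conv_nth)
  then have "M_keeps x i" using True by (auto simp: M_keeps_def)
  then show ?thesis ..
next
  case False
  define A where "A = {v \<in> set x. even v}"
  have A: "finite A" "A \<noteq> {}" using False unfolding A_def by (auto dest: nth_mem)
  then have "Min A \<in> A" by simp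
  then obtain i where "i < length x" "x ! i = Min A" "even (x ! i)"
    by (metis (no_types, lifting) A_def in_set_conv_nth mem_Collect_eq)
  moreover have "Min A \<le> x ! j" if "j < length x" "even (x ! j)" for j
    using A that by (auto simp: A_def intro!: Min_le)
  ultimately have "M_keeps x i" using False by (auto simp: M_keeps_def)
  then show ?thesis ..
qed

lemma M_keeps_value:
  assumes "M_keeps x i" "M_keeps x' i'" "mset x = mset x'"
  shows "x ! i = x' ! i'"
proof -
  have set: "set x = set x'" using assms(3) by (rule mset_eq_setD)
  have M: "x ! i \<in> set x \<and> (if \<forall>v\<in>set x. odd v then \<forall>v\<in>set x. v \<le> x ! i
      else even (x ! i) \<and> (\<forall>v\<in>set x. even v \<longrightarrow> x ! i \<le> v))" if "M_keeps x i" for x i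
    using that unfolding M_keeps_def by (simp add: all_set_conv_all_nth)
  from M[OF assms(1)] M[OF assms(2)] show ?thesis
    unfolding set by (auto split: if_splits intro: le_antisym)
qed

lemma M_move_mset:
  assumes "M_move k x y" "M_move k x' y'" "mset x = mset x'"
  shows "mset y = mset y'"
proof -
  obtain i where i: "M_keeps x i" "y = reduce_others i x"
    using assms(1) unfolding M_move_def by blast
  obtain i' where i': "M_keeps x' i'" "y' = reduce_others i' x'"
    using assms(2) unfolding M_move_def by blast
  have "i < length x" "i' < length x'" using i(1) i'(1) by (simp_all add: M_keeps_def)
  then show ?thesis
    using M_keeps_value[OF i(1) i'(1) assms(3)] assms(3) by (simp add: i i' mset_reduce_others)
qed

lemma M_moves_unique:
  assumes "M_moves k x m" "M_moves k x' m'" "mset x = mset x'"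
  shows "m = m'"
  using assms
proof (induction m arbitrary: x x' m')
  case 0
  then have "terminal k x" by (simp add: M_moves_def)
  then have "terminal k x'" using 0 by (simp add: terminal_iff)
  then have "m' = 0"
    using 0(2) unfolding M_moves_def by (metis M_move_def not0_implies_Suc relpowp_Suc_E2)
  then show ?case by simp
next
  case (Suc m)
  then obtain y where y: "M_move k x y" "M_moves k y m"
    unfolding M_moves_def by (metis relpowp_Suc_E2)
  then have "\<not> terminal k x'" using Suc.prems(3) by (simp add: M_move_def terminal_iff)
  then obtain l where l: "m' = Suc l"
    using Suc.prems(2) by (cases m') (auto simp: M_moves_def)
  then obtain y' where y': "M_move k x' y'" "M_moves k y' l"
    using Suc.prems(2) unfolding M_moves_def by (metis relpowp_Suc_E2)
  have "m = l" using Suc.IH[OF y(2) y'(2)] M_move_mset[OF y(1) y'(1) Suc.prems(3)] .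
  then show ?case using l by simp
qed

lemma ex1_M_moves:
  assumes "0 < k" "length x = k + 1"
  shows "\<exists>!m. M_moves k x m"
proof -
  have "\<exists>m. M_moves k x m" using assms(2)
  proof (induction "sum_list x" arbitrary: x rule: less_induct)
    case less
    show ?case
    proof (cases "terminal k x")
      case True
      then have "M_moves k x 0" by (simp add: M_moves_def)
      then show ?thesis ..
    next
      case False
      have "x \<noteq> []" using less.prems by auto
      then obtain y where y: "M_move k x y" using False ex_M_keeps M_move_def by blast
      have "nim_move k x y" using y less.prems by (rule M_move_legal)
      from sum_list_nim_move[OF this assms(1)] obtain m where "M_moves k y m"
        using less by metis
      then have "M_moves k x (Suc m)" using y unfolding M_moves_def by (metis relpowp_Suc_I2)
      then show ?thesis ..
    qed
  qed
  then show ?thesis using M_moves_unique by blast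
qed

lemma labeled_mono: "i \<le> j \<Longrightarrow> labeled E i \<subseteq> labeled E j"
  by (rule lift_Suc_mono_le[of "labeled E"]) auto

lemma has_label_unique:
  assumes "has_label E x r" "has_label E x s"
  shows "r = s"
proof -
  define L where "L j = remaining_terminal E (labeled E j) \<union> before_terminal E (labeled E j)" for j
  have L: "i \<ge> j" if "x \<in> L i" "x \<in> L j" for i j
  proof (rule ccontr)
    assume "\<not> i \<ge> j"
    then have "labeled E (Suc i) \<subseteq> labeled E j" by (intro labeled_mono) simp
    moreover have "x \<in> labeled E (Suc i)" "x \<notin> labeled E j"
      using that by (auto simp: L_def remaining_terminal_def before_terminal_def)
    ultimately show False by blast
  qed
  have disj: "remaining_terminal E D \<inter> before_terminal E D = {}" for D
    by (auto simp: remaining_terminal_def before_terminal_def)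
  obtain i where i: "r = 2 * i \<and> x \<in> remaining_terminal E (labeled E i) \<or>
      r = 2 * i + 1 \<and> x \<in> before_terminal E (labeled E i)"
    using assms(1) unfolding has_label_def by blast
  obtain j where j: "s = 2 * j \<and> x \<in> remaining_terminal E (labeled E j) \<or>
      s = 2 * j + 1 \<and> x \<in> before_terminal E (labeled E j)"
    using assms(2) unfolding has_label_def by blast
  have "x \<in> L i" "x \<in> L j" using i j unfolding L_def by blast+
  then have "i = j" using L le_antisym by blast
  then show ?thesis using i j disj by blast
qed

lemma has_label_of_labeled: "x \<in> labeled E j \<Longrightarrow> \<exists>r. has_label E x r"
proof (induction j)
  case (Suc j)
  then consider "x \<in> labeled E j" | "x \<in> remaining_terminal E (labeled E j)"
    | "x \<in> before_terminal E (labeled E j)" by auto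
  then show ?case
  proof cases
    case 1
    then show ?thesis by (rule Suc.IH)
  next
    case 2
    then have "has_label E x (2 * j)" unfolding has_label_def by blast
    then show ?thesis ..
  next
    case 3
    then have "has_label E x (2 * j + 1)" unfolding has_label_def by blast
    then show ?thesis ..
  qed
qed simp

lemma ex1_has_label:
  assumes "0 < k"
  shows "\<exists>!r. has_label (nim_move k) x r"
proof -
  have "x \<in> labeled (nim_move k) (Suc (sum_list x))"
  proof (induction "sum_list x" arbitrary: x rule: less_induct)
    case less
    have "y \<in> labeled (nim_move k) (sum_list x)" if "nim_move k x y" for y
    proof -
      have lt: "sum_list y < sum_list x" using sum_list_nim_move[OF that assms] by simp
      then show ?thesis using less labeled_mono[of "Suc (sum_list y)" "sum_list x"] by fastforce
    qed
    then show ?case by (auto simp: remaining_terminal_def)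
  qed
  then have "\<exists>r. has_label (nim_move k) x r" by (rule has_label_of_labeled)
  then show ?thesis by (rule ex_ex1I) (rule has_label_unique)
qed

end

theory Submission
  imports Defs
begin

text \<open>
  Everything rests on an explicit criterion for \<open>\<M>(x) \<ge> m\<close>.  In \<open>m\<close> consecutive moves a pile of
  size \<open>v < m\<close> has to be kept at least \<open>m - v\<close> times, and one pile is kept per move, so any play of
  \<open>m\<close> moves needs \<open>\<Sum>(m - v) \<le> m\<close>, the sum running over the piles \<open>v < m\<close>.  For the M-rule the
  exact condition counts in pairs of moves: every need \<open>m - v\<close> is rounded up to an even number,
  and half of the sum, the \<open>load\<close>, must not exceed \<open>m div 2\<close>, with one extra unit in the parity
  situations called \<open>spare\<close>.  The predicate \<open>lasts\<close> expresses this, and \<open>lasts_iff_M_num\<close>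
  proves that it describes \<open>\<M>\<close>.

  A move that keeps \<open>v\<close> changes the load in a simple way when the number of moves drops from
  \<open>m + 1\<close> to \<open>m\<close> at the same time (\<open>load_move\<close>): a reduced pile contributes the same as before, and the kept pile contributes one
  less precisely if \<open>v \<le> m\<close> and \<open>v\<close> has the parity of \<open>m\<close>.  From this and the criterion follow the
  two properties of \<open>\<M>\<close> that the theorem needs.

  First, \<open>\<M>\<close> is monotone for \<open>\<succeq>\<close> (\<open>M_num_dominates\<close>).  Hence a position \<open>x\<close> can dominate an
  \<open>m\<close>-critical position only if \<open>m \<le> \<M>(x)\<close>.  Conversely, following the M-rule from \<open>x\<close> passes
  through positions dominated by \<open>x\<close> with every smaller value of \<open>\<M>\<close>, and below each of them
  there is a critical one.  So \<open>x\<close> dominates \<open>m\<close>-critical positions exactly for \<open>m \<le> \<M>(x)\<close>,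
  which is \<open>m(x) = \<M>(x)\<close>.

  Second, if some move, chosen by the M-rule or not, leads from \<open>x\<close> to a position \<open>y\<close> with
  \<open>\<M>(y)\<close> even, then \<open>\<M>(x) = \<M>(y) + 1\<close> (\<open>M_num_even_before_move\<close>).  Together with the
  monotonicity, and with the M-move lowering \<open>\<M>\<close> by exactly one, this makes \<open>\<M>\<close> satisfy the
  labeling rules of the remoteness function (\<open>has_label_eqI\<close>), so \<open>\<M> = \<R>\<close>.
\<close>

section \<open>Which positions last a given number of moves\<close>

text \<open>
  The need \<open>m - v\<close> of a pile, rounded up to an even number and halved; for \<open>v > m\<close> the
  truncated subtraction gives the value \<open>0\<close>, as it should be.
\<close>

definition kept_pairs :: "nat \<Rightarrow> nat \<Rightarrow> nat" where
  "kept_pairs m v = (m + 1 - v) div 2"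

definition load :: "nat multiset \<Rightarrow> nat \<Rightarrow> nat" where
  "load X m = (\<Sum>v\<in>#X. kept_pairs m v)"

text \<open>
  The two situations in which the rounding overstates the needs by one unit.  For odd \<open>m\<close>, one
  move is left over by the \<open>m div 2\<close> pairs, and keeping a small even pile in it turns the odd need
  of that pile into an even one.  For even \<open>m\<close>, if all piles are odd and smaller than \<open>m\<close>, keeping
  any pile makes all other piles even and so leads to the first situation with \<open>m - 1\<close>.
\<close>

definition spare :: "nat multiset \<Rightarrow> nat \<Rightarrow> bool" where
  "spare X m \<longleftrightarrow>
     (if even m then \<forall>v\<in>#X. odd v \<and> v < m else \<exists>v\<in>#X. even v \<and> v < m)"

definition lasts :: "nat multiset \<Rightarrow> nat \<Rightarrow> bool" where
  "lasts X m \<longleftrightarrow> load X m \<le> m div 2 + of_bool (spare X m)"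

lemma spare_oddI: "odd m \<Longrightarrow> v \<in># X \<Longrightarrow> even v \<Longrightarrow> v < m \<Longrightarrow> spare X m"
  by (auto simp: spare_def)

lemma spare_evenD: "spare X m \<Longrightarrow> even m \<Longrightarrow> v \<in># X \<Longrightarrow> odd v \<and> v < m"
  by (auto simp: spare_def)

lemma lasts_0: "lasts X 0"
  by (simp add: lasts_def load_def kept_pairs_def sum_mset.neutral)

lemma kept_pairs_Suc_Suc: "kept_pairs (Suc m) (Suc v) = kept_pairs m v"
  by (simp add: kept_pairs_def)

lemma kept_pairs_eq_0: "m \<le> v \<Longrightarrow> kept_pairs m v = 0"
  by (simp add: kept_pairs_def div_eq_0_iff)

lemma kept_pairs_Suc:
  "kept_pairs (Suc m) v = kept_pairs m v + of_bool (v \<le> m \<and> (even v \<longleftrightarrow> even m))"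
proof (cases "v \<le> m")
  case True
  then obtain d where "m = v + d" using le_Suc_ex by blast
  then show ?thesis by (cases "even d") (auto simp: kept_pairs_def elim!: evenE oddE)
qed (simp add: kept_pairs_def)

text \<open>
  The bookkeeping identity that links \<open>lasts\<close> before and after a move.  Writing the reduced piles as
  successors encodes that they were nonempty.
\<close>

lemma load_move:
  "load (add_mset v (image_mset Suc Q)) (Suc m) =
     load (add_mset v Q) m + of_bool (v \<le> m \<and> (even v \<longleftrightarrow> even m))"
  by (simp add: load_def kept_pairs_Suc[of m v] kept_pairs_Suc_Suc image_mset.compositionality comp_def)

text \<open>
  Prepending any move at all extends an even number of moves by one.  The load grows only if the
  kept pile is even and at most \<open>m\<close>, and such a pile supplies the spare unit for \<open>m + 1\<close>.
  If the spare unit was already in use, all piles are odd; then the load does not grow and the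
  reduced piles, of which there is at least one, were even before the move.
\<close>

lemma lasts_before_move:
  assumes "even m" "Q \<noteq> {#}" "lasts (add_mset v Q) m"
  shows "lasts (add_mset v (image_mset Suc Q)) (Suc m)"
proof (cases "spare (add_mset v Q) m")
  case True
  obtain w where w: "w \<in># Q" using assms(2) by blast
  have "spare (add_mset v (image_mset Suc Q)) (Suc m)"
    using True assms(1) w by (auto simp: spare_def)
  moreover have "odd v" using True assms(1) by (simp add: spare_def)
  ultimately show ?thesis using assms(1,3) True by (simp add: lasts_def load_move)
next
  case False
  show ?thesis
  proof (cases "even v \<and> v \<le> m")
    case True
    then have "spare (add_mset v (image_mset Suc Q)) (Suc m)"
      using assms(1) by (auto simp: spare_def)
    then show ?thesis using assms(1,3) False by (auto simp: lasts_def load_move)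
  next
    case ev: False
    then show ?thesis using assms(1,3) False by (auto simp: lasts_def load_move)
  qed
qed

definition M_kept :: "nat multiset \<Rightarrow> nat \<Rightarrow> bool" where
  "M_kept X v \<longleftrightarrow>
     (if \<forall>w\<in>#X. odd w then \<forall>w\<in>#X. w \<le> v
      else even v \<and> (\<forall>w\<in>#X. even w \<longrightarrow> v \<le> w))"

text \<open>
  The M-rule makes the best use of the spare unit.  For even \<open>m\<close> the unit available at \<open>m + 1\<close>
  comes from some small even pile, and then the smallest even pile, which is the kept one,
  lowers the load.  For odd \<open>m\<close> the rule keeps a pile that is odd and at most \<open>m\<close> only if all
  piles are so, as it keeps a largest one; both sides then have a spare unit.  In
  the remaining case the load does not change, and if no pile after the move is even and smaller
  than \<open>m\<close>, then no pile is smaller than \<open>m\<close> and the load is \<open>0\<close>.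
\<close>

lemma lasts_M_move:
  fixes Q :: "nat multiset" and v :: nat
  defines "X \<equiv> add_mset v (image_mset Suc Q)"
  assumes "Q \<noteq> {#}" "M_kept X v"
  shows "lasts X (Suc m) \<longleftrightarrow> lasts (add_mset v Q) m"
proof (cases "even m")
  case True
  have "lasts (add_mset v Q) m" if l: "lasts X (Suc m)"
  proof (cases "spare X (Suc m)")
    case True
    then obtain w where w: "w \<in># X" "even w" "w \<le> m"
      using \<open>even m\<close> by (auto simp: spare_def)
    then have "even v" "v \<le> w" using assms(3) unfolding M_kept_def by (auto split: if_splits)
    then show ?thesis using l w \<open>even m\<close> True unfolding lasts_def X_def load_move by simp
  next
    case False
    then show ?thesis using l \<open>even m\<close> unfolding lasts_def X_def load_move by simp
  qed
  then show ?thesis using lasts_before_move[OF True assms(2)] unfolding X_def by blast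
next
  case False
  note odd = False
  obtain q where q: "q \<in># Q" using assms(2) by blast
  show ?thesis
  proof (cases "odd v \<and> v \<le> m")
    case True
    have "\<forall>w\<in>#X. odd w \<and> w \<le> v"
      using True assms(3) unfolding M_kept_def by (auto split: if_splits)
    then have "spare X (Suc m)" "even q" "q < m"
      using True odd q by (auto simp: spare_def X_def)
    moreover from this have "spare (add_mset v Q) m" using odd q by (auto simp: spare_def)
    ultimately show ?thesis using True odd unfolding lasts_def X_def load_move by simp
  next
    case False
    then have nospare: "\<not> spare X (Suc m)" using odd by (auto simp: spare_def X_def)
    have eq: "load X (Suc m) = load (add_mset v Q) m"
      using False odd unfolding X_def load_move by auto
    have "load (add_mset v Q) m = 0" if ns: "\<not> spare (add_mset v Q) m"
    proof -
      have high: "m < v"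
      proof (rule ccontr)
        assume "\<not> m < v"
        then have "even v" "v \<noteq> m" "v \<le> m" using False odd by auto
        then have "v < m" by simp
        then show False using spare_oddI[of m v "add_mset v Q"] \<open>even v\<close> ns odd by simp
      qed
      have "m \<le> w" if w: "w \<in># Q" for w
      proof (rule ccontr)
        assume less: "\<not> m \<le> w"
        (* If w is odd, Suc w was an even pile, smaller than v, which the M-rule forbids. *)
        have "odd w" using spare_oddI[of m w "add_mset v Q"] less w ns odd by auto
        then have "even (Suc w)" and "Suc w \<in># X" using w by (auto simp: X_def)
        then have "v \<le> Suc w" using assms(3) unfolding M_kept_def by (auto split: if_splits)
        then show False using high less by simp
      qed
      then show ?thesis using high by (simp add: load_def kept_pairs_eq_0)
    qed
    then show ?thesis using nospare eq odd unfolding lasts_def by (cases "spare (add_mset v Q) m") auto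
  qed
qed

text \<open>
  A position that lasts exactly an even number \<open>m\<close> of moves is not reached from one that lasts
  \<open>m + 2\<close>.  If the latter used its spare unit, all its piles would be odd and small, and the
  reduced ones, now even, would give the position after the move the spare unit for \<open>m + 1\<close>.
  Otherwise the load at \<open>m + 1\<close> after the move exceeds the bound by at most one unit, and by
  none if the kept pile is odd and at most \<open>m + 1\<close>.  As there must be no spare unit either, the
  kept pile exceeds \<open>m\<close> and all piles up to \<open>m\<close> are odd.  But odd piles contribute the same at
  \<open>m\<close> and at \<open>m + 1\<close>, so the position would not even last \<open>m\<close> moves.
\<close>

lemma lasts_exactly_even_before_move:
  assumes "even m" "Q \<noteq> {#}" "lasts (add_mset v Q) m" "\<not> lasts (add_mset v Q) (Suc m)"
  shows "\<not> lasts (add_mset v (image_mset Suc Q)) (Suc (Suc m))"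
proof
  let ?Y = "add_mset v Q" and ?X = "add_mset v (image_mset Suc Q)"
  assume l: "lasts ?X (Suc (Suc m))"
  obtain q where q: "q \<in># Q" using assms(2) by blast
  have half: "Suc (Suc m) div 2 = Suc (m div 2)" "Suc m div 2 = m div 2" using assms(1) by auto
  show False
  proof (cases "spare ?X (Suc (Suc m))")
    case True
    then have "odd v" "v \<le> Suc m" "even q" "q \<le> m"
      using q assms(1) by (auto simp: spare_def)
    moreover from this have "spare ?Y (Suc m)"
      using q assms(1) by (intro spare_oddI[of _ q]) auto
    ultimately show False
      using l assms(1,4) True half by (simp add: lasts_def load_move)
  next
    case False
    have Y: "load ?Y (Suc m) \<le> Suc (m div 2)" "\<not> (odd v \<and> v \<le> Suc m)" "\<not> spare ?Y (Suc m)"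
      using l False assms(1,4) half by (auto simp: lasts_def load_move)
    have low: "odd w" if "w \<in># ?Y" "w \<le> m" for w
      using that Y(3) spare_oddI[of "Suc m" w ?Y] assms(1) by auto
    have "m < v"
    proof (rule ccontr)
      assume "\<not> m < v"
      then show False using low[of v] Y(2) by simp
    qed
    then have "\<not> spare ?Y m" using spare_evenD[of ?Y m v] assms(1) by auto
    moreover have "load ?Y (Suc m) = load ?Y m"
      unfolding load_def kept_pairs_Suc using low assms(1)
      by (intro arg_cong[where f = sum_mset] image_mset_cong) auto
    ultimately show False using assms(3,4) half by (auto simp: lasts_def)
  qed
qed

text \<open>
  Two empty piles would each have to be kept in every one of the \<open>m\<close> moves.
\<close>

lemma lasts_two_empty:
  assumes "lasts (add_mset 0 (add_mset 0 X)) m"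
  shows "m = 0"
proof -
  have "2 * ((m + 1) div 2) \<le> load (add_mset 0 (add_mset 0 X)) m"
    by (simp add: load_def kept_pairs_def)
  then have "2 * ((m + 1) div 2) \<le> m div 2 + of_bool (spare (add_mset 0 (add_mset 0 X)) m)"
    using assms by (simp add: lasts_def)
  then show ?thesis
    by (cases "even m") (auto simp: spare_def elim!: evenE oddE)
qed

text \<open>
  Increasing piles never increases the load.  It may destroy the spare unit, but only by changing
  a pile \<open>v < m\<close> with \<open>m - v\<close> odd, and because of the rounding this lowers the load
  by at least one, which makes up for the loss.
\<close>

lemma lasts_mono:
  assumes "list_all2 (\<le>) x y" "lasts (mset x) m"
  shows "lasts (mset y) m"
proof -
  have len: "length x = length y" and le: "\<And>i. i < length x \<Longrightarrow> x ! i \<le> y ! i"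
    using assms(1) by (auto simp: list_all2_conv_all_nth)
  have load: "load (mset z) m = (\<Sum>i<length z. kept_pairs m (z ! i))" for z
    by (simp add: load_def sum_mset_sum_list sum_list_sum_nth atLeast0LessThan flip: mset_map)
  have pile: "kept_pairs m (y ! i) \<le> kept_pairs m (x ! i)" if "i < length x" for i
    unfolding kept_pairs_def using le[OF that] by (intro div_le_mono) simp
  then have weak: "load (mset y) m \<le> load (mset x) m"
    unfolding load len by (intro sum_mono) (simp add: len)
  have strict: "load (mset y) m < load (mset x) m"
    if "i < length x" "x ! i < m" "odd (m - x ! i)" "x ! i \<noteq> y ! i" for i
  proof -
    have "x ! i < y ! i" using le[of i] that by simp
    then have "kept_pairs m (y ! i) \<le> kept_pairs m (Suc (x ! i))"
      unfolding kept_pairs_def by (intro div_le_mono) simp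
    also have "kept_pairs m (Suc (x ! i)) < kept_pairs m (x ! i)"
      using that(2,3)
    proof -
      assume "x ! i < m" "odd (m - x ! i)"
      then obtain d where "m = x ! i + (2 * d + 1)" by (metis le_add_diff_inverse less_imp_le oddE)
      then show ?thesis by (simp add: kept_pairs_def)
    qed
    finally show ?thesis
      unfolding load len using pile that(1)
      by (intro sum_strict_mono_ex1) (auto simp: len)
  qed
  show ?thesis
  proof (cases "spare (mset x) m \<and> \<not> spare (mset y) m")
    case True
    have "\<exists>i<length x. x ! i < m \<and> odd (m - x ! i) \<and> x ! i \<noteq> y ! i"
    proof (cases "even m")
      case True
      have "x \<noteq> y" using \<open>spare (mset x) m \<and> \<not> spare (mset y) m\<close> by auto
      then obtain i where i: "i < length x" "x ! i \<noteq> y ! i" using len nth_equalityI by blast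
      then have "odd (x ! i)" "x ! i < m"
        using True spare_evenD[of "mset x" m "x ! i"] \<open>spare (mset x) m \<and> \<not> spare (mset y) m\<close>
        by simp_all
      then show ?thesis using True i by auto
    next
      case False
      then obtain i where i: "i < length x" "even (x ! i)" "x ! i < m"
        using True by (auto simp: spare_def in_set_conv_nth)
      then have "x ! i \<noteq> y ! i"
        using spare_oddI[of m "y ! i" "mset y"] True False len by auto
      then show ?thesis using i False by auto
    qed
    then have "load (mset y) m < load (mset x) m" using strict by blast
    then show ?thesis using assms(2) True by (simp add: lasts_def)
  next
    case False
    then have "spare (mset x) m \<longrightarrow> spare (mset y) m" by simp
    then show ?thesis using weak assms(2) by (auto simp: lasts_def of_bool_def split: if_splits)
  qed
qed

section \<open>The number of moves under the M-rule\<close>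

lemma M_num_eqI:
  assumes "0 < k" "length x = k + 1" "M_moves k x m"
  shows "M_num k x = m"
  unfolding M_num_def using ex1_M_moves[OF assms(1,2)] assms(3) by (rule the1_equality)

lemma M_num_terminal:
  assumes "0 < k" "length x = k + 1" "terminal k x"
  shows "M_num k x = 0"
  using assms by (intro M_num_eqI) (auto simp: M_moves_def)

lemma M_num_M_move:
  assumes "0 < k" "length x = k + 1" "M_move k x y"
  shows "M_num k x = Suc (M_num k y)"
proof -
  have len: "length y = k + 1"
    using sum_list_nim_move(1)[OF M_move_legal[OF assms(3,2)] assms(1)] assms(2) by simp
  have "M_moves k y (M_num k y)"
    unfolding M_num_def using ex1_M_moves[OF assms(1) len] by (rule theI')
  then have "M_moves k x (Suc (M_num k y))"
    using assms(3) unfolding M_moves_def by (metis relpowp_Suc_I2)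
  then show ?thesis using assms by (intro M_num_eqI)
qed

lemma reduce_others_mset:
  assumes "i < length x" "\<forall>j<length x. j \<noteq> i \<longrightarrow> 0 < x ! j"
  obtains Q where "mset x = add_mset (x ! i) (image_mset Suc Q)"
    "mset (reduce_others i x) = add_mset (x ! i) Q"
proof -
  define R where "R = mset (take i x @ drop (Suc i) x)"
  have x: "mset x = add_mset (x ! i) R"
    using id_take_nth_drop[OF assms(1)] unfolding R_def
    by (metis mset_append mset.simps(2) union_mset_add_mset_right)
  have pos: "0 < w" if "w \<in># R" for w
    using that assms by (auto simp: R_def in_set_conv_nth)
  have R: "R = image_mset Suc (image_mset (\<lambda>v. v - 1) R)"
    using pos by (simp add: image_mset.compositionality comp_def cong: image_mset_cong)
  moreover have "mset (reduce_others i x) = add_mset (x ! i) (image_mset (\<lambda>v. v - 1) R)"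
    using mset_reduce_others[OF assms(1)] x by simp
  ultimately show ?thesis using that x by metis
qed

lemma nim_move_reduce_others:
  assumes "nim_move k x y" "length x = k + 1"
  obtains i where "i < length x" "\<forall>j<length x. j \<noteq> i \<longrightarrow> 0 < x ! j"
    "y = reduce_others i x"
proof -
  obtain S where S: "S \<subseteq> {..<length x}" "card S = k" "\<forall>i\<in>S. 0 < x ! i"
    and y: "y = map (\<lambda>i. if i \<in> S then x ! i - 1 else x ! i) [0..<length x]"
    using assms(1) unfolding nim_move_def by blast
  have "card ({..<length x} - S) = 1"
    using S assms(2) by (simp add: card_Diff_subset finite_subset)
  then obtain i where i: "{..<length x} - S = {i}" by (rule card_1_singletonE)
  then have mem: "j \<in> S \<longleftrightarrow> j \<noteq> i" if "j < length x" for j using that by blast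
  show ?thesis
  proof (rule that)
    show "i < length x" using i by auto
    show "\<forall>j<length x. j \<noteq> i \<longrightarrow> 0 < x ! j" using S(3) mem by blast
    show "y = reduce_others i x"
      using mem by (auto simp: y reduce_others_def nth_list_update intro!: nth_equalityI)
  qed
qed

lemma nim_move_mset:
  assumes "nim_move k x y" "length x = k + 1" "0 < k"
  obtains v Q where "Q \<noteq> {#}" "mset x = add_mset v (image_mset Suc Q)" "mset y = add_mset v Q"
proof -
  obtain i where i: "i < length x" "\<forall>j<length x. j \<noteq> i \<longrightarrow> 0 < x ! j"
    "y = reduce_others i x"
    using nim_move_reduce_others[OF assms(1,2)] .
  obtain Q where Q: "mset x = add_mset (x ! i) (image_mset Suc Q)"
    "mset (reduce_others i x) = add_mset (x ! i) Q"
    using reduce_others_mset[OF i(1,2)] .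
  have "size Q = k" using arg_cong[OF Q(1), of size] assms(2) by simp
  then have "Q \<noteq> {#}" using assms(3) by auto
  then show ?thesis using that Q i(3) by simp
qed

lemma M_move_mset_kept:
  assumes "M_move k x y" "length x = k + 1" "0 < k"
  obtains v Q where "Q \<noteq> {#}" "mset x = add_mset v (image_mset Suc Q)" "mset y = add_mset v Q"
    "M_kept (mset x) v"
proof -
  obtain i where i: "M_keeps x i" "y = reduce_others i x"
    using assms(1) unfolding M_move_def by blast
  have il: "i < length x" using i(1) by (simp add: M_keeps_def)
  obtain i' where i': "i' < length x" "\<forall>j<length x. j \<noteq> i' \<longrightarrow> 0 < x ! j"
    "y = reduce_others i' x"
    using nim_move_reduce_others[OF M_move_legal[OF assms(1,2)] assms(2)] .
  (* A pile other than i' is nonempty and was reduced, so it cannot be the unchanged pile i. *)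
  have "i = i'"
  proof (rule ccontr)
    assume ne: "i \<noteq> i'"
    have "y ! i = x ! i" using i(2) il by (simp add: reduce_others_def)
    moreover have "y ! i = x ! i - 1" using i'(3) il ne by (simp add: reduce_others_def)
    ultimately show False using i'(2) il ne by auto
  qed
  obtain Q where Q: "mset x = add_mset (x ! i) (image_mset Suc Q)"
    "mset (reduce_others i x) = add_mset (x ! i) Q"
    using reduce_others_mset[OF i'(1,2)] \<open>i = i'\<close> by metis
  have "size Q = k" using arg_cong[OF Q(1), of size] assms(2) by simp
  then have "Q \<noteq> {#}" using assms(3) by auto
  have "M_kept (mset x) (x ! i)"
    using i(1) unfolding M_keeps_def M_kept_def by (simp add: all_set_conv_all_nth)
  then show ?thesis using that[OF \<open>Q \<noteq> {#}\<close> Q(1)] Q(2) i(2) by simp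
qed

lemma terminal_two_empty:
  assumes "terminal k x" "length x = k + 1"
  obtains X where "mset x = add_mset 0 (add_mset 0 X)"
proof -
  have "size X = size (filter_mset (\<lambda>v. 0 < v) X) + count X 0" for X :: "nat multiset"
    by (induction X) auto
  from this[of "mset x"] have "2 \<le> count (mset x) 0"
    using assms terminal_iff[of k x] by simp
  then have "replicate_mset 2 0 \<subseteq># mset x" by (simp only: count_le_replicate_mset_subset_eq)
  then obtain X where "mset x = replicate_mset 2 0 + X" by (auto simp: subset_mset.le_iff_add)
  then show ?thesis using that by (simp add: numeral_2_eq_2)
qed

text \<open>
  Both sides obey the same recursion on \<open>m\<close>: a terminal position has two empty piles and lasts
  no move, and from any other position the M-move uses up one.
\<close>

lemma lasts_iff_M_num:
  assumes "0 < k" "length x = k + 1"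
  shows "lasts (mset x) m \<longleftrightarrow> m \<le> M_num k x"
  using assms(2)
proof (induction m arbitrary: x)
  case 0
  then show ?case by (simp add: lasts_0)
next
  case (Suc m)
  show ?case
  proof (cases "terminal k x")
    case True
    then obtain X where "mset x = add_mset 0 (add_mset 0 X)"
      using terminal_two_empty Suc.prems by blast
    then have "\<not> lasts (mset x) (Suc m)" using lasts_two_empty[of X "Suc m"] by auto
    then show ?thesis using M_num_terminal[OF assms(1) Suc.prems True] by simp
  next
    case False
    have "x \<noteq> []" using Suc.prems by auto
    then obtain y where y: "M_move k x y" using False ex_M_keeps M_move_def by blast
    have len: "length y = k + 1"
      using sum_list_nim_move(1)[OF M_move_legal[OF y Suc.prems] assms(1)] Suc.prems by simp
    obtain v Q where Q: "Q \<noteq> {#}" "mset x = add_mset v (image_mset Suc Q)" "mset y = add_mset v Q"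
      "M_kept (mset x) v"
      using M_move_mset_kept[OF y Suc.prems assms(1)] .
    have "lasts (mset x) (Suc m) \<longleftrightarrow> lasts (mset y) m"
      using lasts_M_move[of Q v m] Q by simp
    then show ?thesis using Suc.IH[OF len] M_num_M_move[OF assms(1) Suc.prems y] by simp
  qed
qed

lemma M_num_mono:
  assumes "0 < k" "length y = k + 1" "list_all2 (\<le>) x y"
  shows "M_num k x \<le> M_num k y"
proof -
  have "length x = k + 1" using assms(2,3) by (simp add: list_all2_lengthD)
  then show ?thesis using assms lasts_mono lasts_iff_M_num by blast
qed

lemma M_num_even_before_move:
  assumes "0 < k" "length x = k + 1" "nim_move k x y" "even (M_num k y)"
  shows "M_num k x = Suc (M_num k y)"
proof -
  have len: "length y = k + 1" using sum_list_nim_move(1)[OF assms(3,1)] assms(2) by simp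
  obtain v Q where Q: "Q \<noteq> {#}" "mset x = add_mset v (image_mset Suc Q)" "mset y = add_mset v Q"
    using nim_move_mset[OF assms(3,2,1)] .
  note Y = lasts_iff_M_num[OF assms(1) len, unfolded Q]
    and X = lasts_iff_M_num[OF assms(1,2), unfolded Q]
  have "lasts (add_mset v Q) (M_num k y)" "\<not> lasts (add_mset v Q) (Suc (M_num k y))"
    by (simp_all add: Y)
  from lasts_before_move[OF assms(4) Q(1) this(1)]
    lasts_exactly_even_before_move[OF assms(4) Q(1) this]
  show ?thesis by (simp add: X)
qed

lemma reduce_others_le: "list_all2 (\<le>) (reduce_others i x) x"
  by (cases "i < length x")
    (auto simp: reduce_others_def list_all2_conv_all_nth nth_list_update)

lemma ex_M_move_of_M_num_pos:
  assumes "0 < k" "length x = k + 1" "0 < M_num k x"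
  obtains y where "M_move k x y" "length y = k + 1" "list_all2 (\<le>) y x"
    "M_num k x = Suc (M_num k y)"
proof -
  have nt: "\<not> terminal k x" using M_num_terminal[OF assms(1,2)] assms(3) by auto
  have "x \<noteq> []" using assms(2) by auto
  then obtain i where i: "M_move k x (reduce_others i x)"
    using nt ex_M_keeps M_move_def by blast
  then show ?thesis
    using that[OF i] M_num_M_move[OF assms(1,2) i] assms(2) reduce_others_le by simp
qed

section \<open>Remoteness\<close>

text \<open>
  Under these conditions the rounds of the labeling procedure remove the level sets of \<open>f\<close> in
  pairs: after \<open>j\<close> rounds exactly the vertices with \<open>f < 2 * j\<close> are gone.  A vertex with
  \<open>f = 2 * j\<close> is then terminal, since an edge to a remaining vertex would, by monotonicity, lead to
  the even value \<open>2 * j\<close> and so force \<open>f = 2 * j + 1\<close>; a vertex with a larger value still has its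
  edge to the next lower value.  The set \<open>C\<close> confines the argument to a part of the graph that
  no edge leaves, here the positions with \<open>k + 1\<close> piles.
\<close>

lemma has_label_eqI:
  assumes closed: "\<And>x y. x \<in> C \<Longrightarrow> E x y \<Longrightarrow> y \<in> C"
    and even: "\<And>x y. x \<in> C \<Longrightarrow> E x y \<Longrightarrow> even (f y) \<Longrightarrow> f x = Suc (f y)"
    and mono: "\<And>x y. x \<in> C \<Longrightarrow> E x y \<Longrightarrow> f y \<le> f x"
    and down: "\<And>x. x \<in> C \<Longrightarrow> 0 < f x \<Longrightarrow> \<exists>y. E x y \<and> f x = Suc (f y)"
    and "x \<in> C"
  shows "has_label E x (f x)"
proof -
  have rt: "x \<in> remaining_terminal E D \<longleftrightarrow> f x = 2 * j"
    if D: "\<And>x. x \<in> C \<Longrightarrow> x \<in> D \<longleftrightarrow> f x < 2 * j" and x: "x \<in> C" for x D j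
  proof
    assume "x \<in> remaining_terminal E D"
    then have *: "2 * j \<le> f x" "\<And>y. E x y \<Longrightarrow> f y < 2 * j"
      using D closed x by (auto simp: remaining_terminal_def)
    then show "f x = 2 * j" using down[OF x]
      by (metis less_Suc_eq_le le_antisym le_less_trans not_gr_zero zero_le Suc_leI)
  next
    assume "f x = 2 * j"
    moreover have "f y < 2 * j" if "E x y" for y
      using mono[OF x that] even[OF x that] \<open>f x = 2 * j\<close> by (cases "f y = 2 * j") auto
    ultimately show "x \<in> remaining_terminal E D"
      using D closed x by (force simp: remaining_terminal_def)
  qed
  have bt: "x \<in> before_terminal E D \<longleftrightarrow> f x = 2 * j + 1"
    if D: "\<And>x. x \<in> C \<Longrightarrow> x \<in> D \<longleftrightarrow> f x < 2 * j" and x: "x \<in> C" for x D j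
  proof
    assume "x \<in> before_terminal E D"
    then obtain y where "E x y" "f y = 2 * j"
      using rt[OF D] closed[OF x] by (auto simp: before_terminal_def)
    then show "f x = 2 * j + 1" using even[OF x] by simp
  next
    assume fx: "f x = 2 * j + 1"
    then obtain y where "E x y" "f y = 2 * j" using down[OF x] by auto
    then show "x \<in> before_terminal E D"
      using rt[OF D] closed[OF x] D[OF x] fx by (auto simp: before_terminal_def)
  qed
  have lab: "x \<in> labeled E j \<longleftrightarrow> f x < 2 * j" if "x \<in> C" for x j
    using that
  proof (induction j arbitrary: x)
    case (Suc j)
    then show ?case using rt[OF Suc.IH, of x] bt[OF Suc.IH, of x] by auto
  qed simp
  have "f x = 2 * (f x div 2) \<or> f x = 2 * (f x div 2) + 1" by linarith
  then show ?thesis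
    unfolding has_label_def using rt[OF lab \<open>x \<in> C\<close>] bt[OF lab \<open>x \<in> C\<close>] by blast
qed

lemma remoteness_eq_M_num:
  assumes "0 < k" "length x = k + 1"
  shows "remoteness (nim_move k) x = M_num k x"
  unfolding remoteness_def
proof (rule the1_equality[OF ex1_has_label[OF assms(1)]], rule has_label_eqI)
  fix x y :: "nat list"
  assume x: "x \<in> {x. length x = k + 1}" and xy: "nim_move k x y"
  show "y \<in> {x. length x = k + 1}" using x sum_list_nim_move(1)[OF xy assms(1)] by simp
  show "M_num k x = Suc (M_num k y)" if "even (M_num k y)"
    using M_num_even_before_move[OF assms(1) _ xy that] x by simp
  obtain i where "y = reduce_others i x" using nim_move_reduce_others[OF xy] x by auto
  then show "M_num k y \<le> M_num k x"
    using x M_num_mono[OF assms(1)] reduce_others_le by simp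
next
  fix x :: "nat list"
  assume x: "x \<in> {x. length x = k + 1}" "0 < M_num k x"
  then show "\<exists>y. nim_move k x y \<and> M_num k x = Suc (M_num k y)"
    using ex_M_move_of_M_num_pos[OF assms(1), of x] M_move_legal[of k x] by (metis mem_Collect_eq)
qed (use assms(2) in simp)

section \<open>Critical positions\<close>

lemma dominates_iff: "dominates x y \<longleftrightarrow> list_all2 (\<le>) (sort y) (sort x)"
  by (auto simp: dominates_def list_all2_conv_all_nth)

lemma dominates_trans: "dominates x y \<Longrightarrow> dominates y z \<Longrightarrow> dominates x z"
  by (fastforce simp: dominates_def intro: order_trans)

text \<open>
  A move compares positions pile by pile, while domination compares the sorted positions; the
  next two lemmas pass from the former to the latter.
\<close>

lemma insort_mono:
  fixes a b :: "'a::linorder"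
  assumes "list_all2 (\<le>) xs ys" "a \<le> b" "sorted xs" "sorted ys"
  shows "list_all2 (\<le>) (insort a xs) (insort b ys)"
  using assms
proof (induction xs ys arbitrary: a b rule: list_all2_induct)
  case (Cons x xs y ys)
  have "insort x xs = x # xs" "insort y ys = y # ys"
    using Cons.prems by (auto intro: insort_is_Cons)
  then show ?case
    using Cons.IH[of x b] Cons.IH[of a y] Cons.IH[of a b] Cons.hyps Cons.prems by auto
qed simp

lemma sort_mono:
  fixes x y :: "'a::linorder list"
  assumes "list_all2 (\<le>) x y"
  shows "list_all2 (\<le>) (sort x) (sort y)"
  using assms by (induction x y rule: list_all2_induct) (auto intro: insort_mono)

lemma M_num_dominates:
  assumes "0 < k" "length x = k + 1" "dominates x y"
  shows "M_num k y \<le> M_num k x"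
proof -
  have len: "length y = k + 1" using assms(2,3) by (simp add: dominates_def)
  have "lasts (mset x) m" if "lasts (mset y) m" for m
    using lasts_mono[of "sort y" "sort x" m] assms(3) that by (simp add: dominates_iff)
  then show ?thesis
    using lasts_iff_M_num[OF assms(1,2)] lasts_iff_M_num[OF assms(1) len] by blast
qed

lemma sum_list_strictly_dominates:
  assumes "strictly_dominates x y"
  shows "sum_list y < sum_list x"
proof -
  have le: "list_all2 (\<le>) (sort y) (sort x)" and ne: "sort y \<noteq> sort x"
    using assms by (auto simp: strictly_dominates_def dominates_iff)
  have "sum_list u < sum_list w" if "list_all2 (\<le>) u w" "u \<noteq> w" for u w :: "nat list"
    using that
  proof (induction u w rule: list_all2_induct)
    case (Cons a u b w)
    then show ?case by (cases "u = w") auto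
  qed simp
  from this[OF le ne] show ?thesis by (metis mset_sort sum_mset_sum_list)
qed

text \<open>
  Replacing a noncritical position by a strictly dominated one of the same value lowers the number
  of stones, so this ends at a critical position.
\<close>

lemma dominates_critical:
  assumes "length x = k + 1"
  obtains z where "critical k (M_num k x) z" "dominates x z"
proof -
  have "\<exists>z. critical k (M_num k x) z \<and> dominates x z" using assms
  proof (induction "sum_list x" arbitrary: x rule: less_induct)
    case less
    show ?case
    proof (cases "critical k (M_num k x) x")
      case True
      then show ?thesis by (auto simp: dominates_def)
    next
      case False
      then obtain y where y: "length y = k + 1" "M_num k y = M_num k x" "strictly_dominates x y"
        using less.prems by (auto simp: critical_def)
      then obtain z where "critical k (M_num k x) z" "dominates y z"
        using less.hyps[OF sum_list_strictly_dominates[OF y(3)] y(1)] by auto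
      then show ?thesis using y(3) dominates_trans by (auto simp: strictly_dominates_def)
    qed
  qed
  then show ?thesis using that by blast
qed

text \<open>
  The play by the M-rule provides these positions: it only removes stones and lowers \<open>\<M>\<close> by
  one in each move, so it skips no value.
\<close>

lemma dominates_M_num_eq:
  assumes "0 < k" "length x = k + 1" "m \<le> M_num k x"
  obtains y where "length y = k + 1" "dominates x y" "M_num k y = m"
proof -
  have "\<exists>y. length y = k + 1 \<and> dominates x y \<and> M_num k y = m"
    using assms(2,3)
  proof (induction "M_num k x" arbitrary: x)
    case 0
    then show ?case by (auto simp: dominates_def)
  next
    case (Suc l)
    show ?case
    proof (cases "m = Suc l")
      case True
      then show ?thesis using Suc.hyps(2) Suc.prems by (auto simp: dominates_def)
    next
      case False
      obtain y where y: "length y = k + 1" "list_all2 (\<le>) y x" "M_num k x = Suc (M_num k y)"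
        using ex_M_move_of_M_num_pos[OF assms(1) Suc.prems(1)] Suc.hyps(2) by auto
      then obtain z where "length z = k + 1" "dominates y z" "M_num k z = m"
        using Suc.hyps(1)[of y] Suc.hyps(2) Suc.prems(2) False by auto
      moreover have "dominates x y" using sort_mono[OF y(2)] by (simp add: dominates_iff)
      ultimately show ?thesis using dominates_trans by blast
    qed
  qed
  then show ?thesis using that by blast
qed

lemma dominates_critical_iff:
  assumes "0 < k" "length x = k + 1"
  shows "(\<exists>z. critical k m z \<and> dominates x z) \<longleftrightarrow> m \<le> M_num k x"
proof
  assume "\<exists>z. critical k m z \<and> dominates x z"
  then show "m \<le> M_num k x" using M_num_dominates[OF assms] by (auto simp: critical_def)
next
  assume "m \<le> M_num k x"
  then obtain y where y: "length y = k + 1" "dominates x y" "M_num k y = m"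
    using dominates_M_num_eq[OF assms] by blast
  obtain z where "critical k m z" "dominates y z" using dominates_critical[OF y(1)] y(3) by blast
  then show "\<exists>z. critical k m z \<and> dominates x z" using y(2) dominates_trans by blast
qed

lemma m_num_eq_M_num:
  assumes "0 < k" "length x = k + 1"
  shows "m_num k x = M_num k x"
proof -
  have "(\<exists>z. critical k m z \<and> dominates x z) \<and> (\<forall>z. critical k (m + 1) z \<longrightarrow> \<not> dominates x z)
      \<longleftrightarrow> m = M_num k x" for m
    using dominates_critical_iff[OF assms, of m] dominates_critical_iff[OF assms, of "m + 1"]
    by auto
  then show ?thesis unfolding m_num_def by simp
qed

theorem theorem2:
  fixes k n :: nat and x :: "nat list"
  assumes "k \<ge> 1" and "n = k + 1" and "length x = n"
  shows "m_num k x = M_num k x \<and> M_num k x = remoteness (nim_move k) x"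
  using assms by (simp add: m_num_eq_M_num remoteness_eq_M_num)

end
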